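(* Let $(X,f_{1,\infty})$ and $(Y,g_{1,\infty})$ be two non-autonomous systems such that $f_{1,\infty}$ is topologically conjugate to $g_{1,\infty}$, i.e. there is a homeomorphism $h:X\to Y$ with $h\circ f_n=g_n\circ h$ for every $n\in\mathbb{N}$. Then $f_{1,\infty}$ has the strong specification property (SSP) if and only if $g_{1,\infty}$ has SSP.
   Context: A non-autonomous (discrete) system $(X,f_{1,\infty})$ consists of a compact metric space $(X,d)$ and a sequence $f_{1,\infty}=(f_n)_{n\ge 1}$ of continuous surjective maps $f_n:X\to X$. Write $\mathbb{N}=\{1,2,\dots\}$, $f_1^0=\mathrm{id}$ and $f_1^n=f_n\circ\cdots\circ f_1$ for $n\ge1$. A point $z$ is periodic with period $p\in\mathbb{N}$ if $f_1^{pm}(z)=z$ for every $m\in\mathbb{N}$ ($p$ need not be minimal). $(X,f_{1,\infty})$ has the strong specification property (SSP) if for every $\epsilon>0$ there is a positive integer $M(\epsilon)$ such that for every $s\in\mathbb{N}$, every choice of points $x_1,\dots,x_s\in X$, every sequence $a_1\le b_1<a_2\le b_2<\cdots<a_s\le b_s$ of non-negative integers with $a_j-b_{j-1}>M(\epsilon)$ for $2\le j\le s$, and every integer $p>M(\epsilon)+b_s-a_1$, there is a periodic point $z\in X$ with period $p$ such that $d(f_1^j(z),f_1^j(x_i))<\epsilon$ for all $a_i\le j\le b_i$, $1\le i\le s$. *)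

theory Defs
  imports "HOL-Analysis.Analysis"
begin

text \<open>
  The compact metric space is a carrier set X in a metric-space type, with the metric of the type
  restricted to X. The maps are indexed from 1: the value f 0 is never used, and
  the maps matter only on X.
\<close>

definition nonautonomous_system :: "'a::metric_space set \<Rightarrow> (nat \<Rightarrow> 'a \<Rightarrow> 'a) \<Rightarrow> bool" where
  "nonautonomous_system X f \<longleftrightarrow>
     compact X \<and> (\<forall>n\<ge>1. continuous_on X (f n) \<and> f n ` X = X)"

primrec iter :: "(nat \<Rightarrow> 'a \<Rightarrow> 'a) \<Rightarrow> nat \<Rightarrow> 'a \<Rightarrow> 'a" where
  "iter f 0 = id"
| "iter f (Suc n) = f (Suc n) \<circ> iter f n"

definition periodic_with :: "(nat \<Rightarrow> 'a \<Rightarrow> 'a) \<Rightarrow> nat \<Rightarrow> 'a \<Rightarrow> bool" where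
  "periodic_with f p z \<longleftrightarrow> p \<ge> 1 \<and> (\<forall>m\<ge>1. iter f (p * m) z = z)"

text \<open>
  The points and times are families of which only the indices 1 to s matter.
  The natural-number subtractions do not truncate, since b (j - 1) < a j and a 1 \<le> b s.
\<close>

definition strong_specification :: "'a::metric_space set \<Rightarrow> (nat \<Rightarrow> 'a \<Rightarrow> 'a) \<Rightarrow> bool" where
  "strong_specification X f \<longleftrightarrow>
     (\<forall>\<epsilon>>0. \<exists>M\<ge>1. \<forall>s\<ge>1. \<forall>(x :: nat \<Rightarrow> 'a) (a :: nat \<Rightarrow> nat) (b :: nat \<Rightarrow> nat) (p :: nat).
        (\<forall>i\<in>{1..s}. x i \<in> X) \<longrightarrow>
        (\<forall>i\<in>{1..s}. a i \<le> b i) \<longrightarrow>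
        (\<forall>j\<in>{2..s}. b (j - 1) < a j \<and> a j - b (j - 1) > M) \<longrightarrow>
        p > M + b s - a 1 \<longrightarrow>
        (\<exists>z\<in>X. periodic_with f p z \<and>
           (\<forall>i\<in>{1..s}. \<forall>j\<in>{a i..b i}. dist (iter f j z) (iter f j (x i)) < \<epsilon>)))"

definition topologically_conjugate ::
  "'a::metric_space set \<Rightarrow> (nat \<Rightarrow> 'a \<Rightarrow> 'a) \<Rightarrow> 'b::metric_space set \<Rightarrow> (nat \<Rightarrow> 'b \<Rightarrow> 'b) \<Rightarrow> bool" where
  "topologically_conjugate X f Y g \<longleftrightarrow>
     (\<exists>h k. homeomorphism X Y h k \<and> (\<forall>n\<ge>1. \<forall>x\<in>X. h (f n x) = g n (h x)))"

end

theory Submission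
  imports Defs
begin

text \<open>A conjugacy intertwines not only the single maps but all their compositions from time 1,
  so \<open>h\<close> carries the f-orbit of \<open>x\<close> to the g-orbit of \<open>h x\<close>
  with the same time indices (\<open>iter_conjugate\<close>). Periods, gaps and time windows
  therefore transfer unchanged, and only distances can be distorted. Compactness of \<open>X\<close>
  makes \<open>h\<close> uniformly continuous, which controls that distortion at all times at once:
  tracing within a suitable \<delta> in \<open>X\<close> becomes tracing within \<epsilon> in
  \<open>Y\<close> (\<open>strong_specification_conjugate\<close>). Since conjugacy is symmetric
  (\<open>topologically_conjugate_sym\<close>), this one implication gives both directions.\<close>

lemma iter_in_carrier:
  assumes "nonautonomous_system X f" and "x \<in> X"
  shows "iter f n x \<in> X"
  using assms by (induction n) (auto simp: nonautonomous_system_def)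

text \<open>The intertwining relation is available only on \<open>X\<close>; invariance of
  \<open>X\<close> under the iterates is what lets the induction apply it at
  \<open>iter f n x\<close>.\<close>

lemma iter_conjugate:
  assumes "nonautonomous_system X f"
    and "\<forall>n\<ge>1. \<forall>x\<in>X. h (f n x) = g n (h x)"
    and "x \<in> X"
  shows "iter g n (h x) = h (iter f n x)"
  using assms by (induction n) (auto simp: iter_in_carrier)

text \<open>Apply \<open>k\<close> to the relation \<open>h (f n (k y)) = g n y\<close>; it cancels
  \<open>h\<close> because \<open>f n\<close> maps \<open>X\<close> into itself.\<close>

lemma topologically_conjugate_sym:
  assumes "nonautonomous_system X f" and "topologically_conjugate X f Y g"
  shows "topologically_conjugate Y g X f"
proof -
  obtain h k where hom: "homeomorphism X Y h k"
    and conj: "\<forall>n\<ge>1. \<forall>x\<in>X. h (f n x) = g n (h x)"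
    using assms(2) unfolding topologically_conjugate_def by blast
  have "k (g n y) = f n (k y)" if "n \<ge> 1" and "y \<in> Y" for n y
  proof -
    have ky: "k y \<in> X" "h (k y) = y"
      using hom \<open>y \<in> Y\<close> by (auto simp: homeomorphism_def)
    then have "f n (k y) \<in> X"
      using assms(1) \<open>n \<ge> 1\<close> by (auto simp: nonautonomous_system_def)
    then have "k (h (f n (k y))) = f n (k y)"
      using hom by (simp add: homeomorphism_def)
    with conj ky \<open>n \<ge> 1\<close> show ?thesis by simp
  qed
  with hom show ?thesis
    unfolding topologically_conjugate_def by (meson homeomorphism_sym)
qed

lemma strong_specification_conjugate:
  assumes sys: "nonautonomous_system X f"
    and "topologically_conjugate X f Y g"
    and spec: "strong_specification X f"
  shows "strong_specification Y g"
  unfolding strong_specification_def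
proof (intro allI impI)
  fix \<epsilon> :: real
  assume "\<epsilon> > 0"
  obtain h k where hom: "homeomorphism X Y h k"
    and conj: "\<forall>n\<ge>1. \<forall>x\<in>X. h (f n x) = g n (h x)"
    using assms(2) unfolding topologically_conjugate_def by blast
  note iter_h = iter_conjugate[OF sys conj]
  \<comment> \<open>Mere continuity would give a \<delta> depending on the orbit point; a single
    \<delta> must serve all points and times, since M may depend on \<epsilon> alone.\<close>
  have "uniformly_continuous_on X h"
    using hom sys unfolding homeomorphism_def nonautonomous_system_def
    by (intro compact_uniformly_continuous) simp_all
  then obtain \<delta> where "\<delta> > 0"
    and \<delta>: "\<And>u v. u \<in> X \<Longrightarrow> v \<in> X \<Longrightarrow> dist u v < \<delta> \<Longrightarrow> dist (h u) (h v) < \<epsilon>"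
    using \<open>\<epsilon> > 0\<close> unfolding uniformly_continuous_on_def by metis
  \<comment> \<open>The gap constant that f has for \<delta> serves g for \<epsilon>, because
    conjugation leaves times alone.\<close>
  obtain M where "M \<ge> 1" and M: "\<And>(s::nat) x a b p. s \<ge> 1 \<Longrightarrow> \<forall>i\<in>{1..s}. x i \<in> X \<Longrightarrow>
      \<forall>i\<in>{1..s}. a i \<le> b i \<Longrightarrow>
      \<forall>j\<in>{2..s}. b (j - 1) < a j \<and> a j - b (j - 1) > M \<Longrightarrow>
      p > M + b s - a 1 \<Longrightarrow>
      \<exists>z\<in>X. periodic_with f p z \<and>
        (\<forall>i\<in>{1..s}. \<forall>j\<in>{a i..b i}. dist (iter f j z) (iter f j (x i)) < \<delta>)"
    using spec[unfolded strong_specification_def, rule_format, OF \<open>\<delta> > 0\<close>]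
    by blast
  show "\<exists>M\<ge>1. \<forall>s\<ge>1. \<forall>(y :: nat \<Rightarrow> 'b) a b p.
      (\<forall>i\<in>{1..s}. y i \<in> Y) \<longrightarrow>
      (\<forall>i\<in>{1..s}. a i \<le> b i) \<longrightarrow>
      (\<forall>j\<in>{2..s}. b (j - 1) < a j \<and> a j - b (j - 1) > M) \<longrightarrow>
      p > M + b s - a 1 \<longrightarrow>
      (\<exists>z\<in>Y. periodic_with g p z \<and>
        (\<forall>i\<in>{1..s}. \<forall>j\<in>{a i..b i}. dist (iter g j z) (iter g j (y i)) < \<epsilon>))"
  proof (intro exI[of _ M] conjI allI impI)
    show "M \<ge> 1" by fact
  next
    fix s p :: nat and y :: "nat \<Rightarrow> 'b" and a b :: "nat \<Rightarrow> nat"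
    assume s: "s \<ge> 1" and y: "\<forall>i\<in>{1..s}. y i \<in> Y"
      and times: "\<forall>i\<in>{1..s}. a i \<le> b i"
        "\<forall>j\<in>{2..s}. b (j - 1) < a j \<and> a j - b (j - 1) > M" "p > M + b s - a 1"
    have ky: "k (y i) \<in> X" "h (k (y i)) = y i" if "i \<in> {1..s}" for i
      using hom y that by (auto simp: homeomorphism_def)
    \<comment> \<open>Pull the prescribed points back to \<open>X\<close> by \<open>k\<close> and
      trace their f-orbits there; the image of the tracing point under \<open>h\<close> is the
      witness in \<open>Y\<close>.\<close>
    obtain z where z: "z \<in> X" "periodic_with f p z"
      and close: "\<forall>i\<in>{1..s}. \<forall>j\<in>{a i..b i}. dist (iter f j z) (iter f j (k (y i))) < \<delta>"
      using M[OF s _ times, of "\<lambda>i. k (y i)"] ky(1) by blast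
    show "\<exists>z\<in>Y. periodic_with g p z \<and>
        (\<forall>i\<in>{1..s}. \<forall>j\<in>{a i..b i}. dist (iter g j z) (iter g j (y i)) < \<epsilon>)"
    proof (intro bexI[of _ "h z"] conjI ballI)
      show "h z \<in> Y"
        using hom z(1) by (auto simp: homeomorphism_def)
      show "periodic_with g p (h z)"
        using z by (simp add: periodic_with_def iter_h)
    next
      fix i j
      assume i: "i \<in> {1..s}" and j: "j \<in> {a i..b i}"
      have "dist (h (iter f j z)) (h (iter f j (k (y i)))) < \<epsilon>"
        using close i j z(1) ky(1)[OF i] by (intro \<delta> iter_in_carrier[OF sys]) auto
      then show "dist (iter g j (h z)) (iter g j (y i)) < \<epsilon>"
        using iter_h[OF z(1)] iter_h[OF ky(1)[OF i]] ky(2)[OF i] by simp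
    qed
  qed
qed

theorem corollary3p3:
  fixes X :: "'a::metric_space set" and f :: "nat \<Rightarrow> 'a \<Rightarrow> 'a"
    and Y :: "'b::metric_space set" and g :: "nat \<Rightarrow> 'b \<Rightarrow> 'b"
  assumes "nonautonomous_system X f"
    and "nonautonomous_system Y g"
    and "topologically_conjugate X f Y g"
  shows "strong_specification X f \<longleftrightarrow> strong_specification Y g"
  using strong_specification_conjugate[OF assms(1,3)]
    strong_specification_conjugate[OF assms(2) topologically_conjugate_sym[OF assms(1,3)]]
  by blast

end
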